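(* Let $\mathcal J=(M,\lambda,\tau)$ be a noetherian reduction structure with disjoint cones and well-founded order $\prec$. Suppose that for all $x^\delta,x^{\delta'},x^\varepsilon\in\mathcal T$, $x^\delta\succ x^{\delta'}$ implies $x^{\delta+\varepsilon}\succ x^{\delta'+\varepsilon}\succeq x^\varepsilon$. Let $\mathcal F$ be a marked set over $\mathcal J$ and let $x^\alpha,x^{\alpha'},x^{\alpha''}\in M$ with $x^\alpha\mid\operatorname{lcm}(x^{\alpha'},x^{\alpha''})$. Then, in testing whether $\mathcal F$ is a marked basis, it is not necessary to control that $S(f_{\alpha'},f_{\alpha''})$ reduces to $0$ if $S(f_{\alpha'},f_\alpha)$ and $S(f_{\alpha''},f_\alpha)$ have already been checked. That is, $\mathcal F$ is a marked basis if and only if $S(f_{\alpha'},f_\alpha)\rightarrow^+_{\mathcal F\mathcal J}0\downarrow$, $S(f_{\alpha''},f_\alpha)\rightarrow^+_{\mathcal F\mathcal J}0\downarrow$, and $S(f_{\beta'},f_\beta)\rightarrow^+_{\mathcal F\mathcal J}0\downarrow$ for all $x^\beta,x^{\beta'}\in M$ with $\operatorname{lcm}(x^\beta,x^{\beta'})\in\operatorname{cone}(x^{\beta'})$ and $\{x^\beta,x^{\beta'}\}\neq\{x^{\alpha'},x^{\alpha''}\}$.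
   Context: Let $A$ be a field, $\mathcal P=A[x_1,\dots,x_n]$, and $\mathcal T$ the set of terms $x^\alpha=x_1^{\alpha_1}\cdots x_n^{\alpha_n}$, $\alpha\in\mathbb N^n$. $\operatorname{Supp}(g)\subset\mathcal T$ is the set of terms with nonzero coefficient in $g$; $\langle V\rangle$ is the $A$-span of $V\subset\mathcal P$ and $(V)$ the ideal of $\mathcal P$ generated by $V$. A semigroup ideal is a subset of $\mathcal T$ closed under multiplication by terms; an order ideal is the complement in $\mathcal T$ of a semigroup ideal. A reduction structure (RS) is a triple $\mathcal J=(M,\lambda=\{\lambda_\alpha\}_{x^\alpha\in M},\tau=\{\tau_\alpha\}_{x^\alpha\in M})$ where $M\subset\mathcal T$ is finite, $J$ denotes the semigroup ideal generated by $M$, each $\tau_\alpha\subseteq\mathcal T$ is an order ideal, $\operatorname{cone}(x^\alpha)=\{x^{\alpha+\eta}: x^\eta\in\tau_\alpha\}$, $\bigcup_{x^\alpha\in M}\operatorname{cone}(x^\alpha)=J$, and $\lambda_\alpha\subseteq\mathcal T\setminus\operatorname{cone}(x^\alpha)$. $\mathsf N(J)=\mathcal T\setminus J$. All RSs are assumed to have finite tails: every $\lambda_\alpha$ is finite. $\mathcal J$ has disjoint cones if $\operatorname{cone}(x^\alpha)\cap\operatorname{cone}(x^{\alpha'})=\emptyset$ for distinct $x^\alpha,x^{\alpha'}\in M$. A marked set over $\mathcal J$ is a set $\mathcal F=\{f_\alpha\}_{x^\alpha\in M}\subset\mathcal P$ such that $x^\alpha$ has coefficient $1$ in $f_\alpha$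 and $\operatorname{Supp}(f_\alpha-x^\alpha)\subset\lambda_\alpha$. It is a marked basis if $(\mathcal F)\oplus\langle\mathsf N(J)\rangle=\mathcal P$. The S-polynomial is $S(f_{\alpha'},f_\alpha)=x^\eta f_\alpha-x^{\eta'}f_{\alpha'}$, where $x^{\eta+\alpha}=x^{\eta'+\alpha'}=\operatorname{lcm}(x^\alpha,x^{\alpha'})$. One-step reduction: $g\rightarrow_{\mathcal F\mathcal J}h$ if there are $x^\gamma\in\operatorname{Supp}(g)$ with coefficient $c$ in $g$, $x^\alpha\in M$ and $x^\eta\in\tau_\alpha$ with $x^\gamma=x^{\alpha+\eta}$ and $h=g-cx^\eta f_\alpha$. $\rightarrow^+_{\mathcal F\mathcal J}$ is the reflexive-transitive closure. $g\rightarrow^+_{\mathcal F\mathcal J}l\downarrow$ means $g\rightarrow^+_{\mathcal F\mathcal J}l$ and $\operatorname{Supp}(l)\subset\mathsf N(J)$. $\mathcal J$ is noetherian if for every marked set over it there is no infinite chain of one-step reductions. $\mathcal J$ is ordered by a well-founded order $\prec$ on $\mathcal T$ (a strict partial order for which every nonempty subset has minimal elements) if $x^{\gamma+\eta}\prec x^{\alpha+\eta}$ for all $x^\alpha\in M$, $x^\gamma\in\lambda_\alpha$, $x^\eta\in\tau_\alpha$. Noetherian and ordered are treated as synonyms, and a noetherian $\mathcal J$ comes with a fixed such order $\prec$.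
   Formalization: Each order ideal τ_α is assumed nonempty (so x^α lies in cone(x^α)); if an empty τ_α were allowed, the order would not constrain the tail of f_α and the claim would fail, e.g. for M = {x², xyz, u², x²y} with empty cone(x²y). *)

theory Defs
  imports Complex_Main "HOL-Library.Poly_Mapping"
begin

text \<open>
  The indeterminates are the elements of a finite type \<open>'x\<close>.
  A term \<open>x^\<alpha>\<close> is identified with its exponent vector \<open>\<alpha>\<close>, so terms are multiplied by
  adding exponents. The set of terms with nonzero coefficient in \<open>g\<close> is \<open>Poly_Mapping.keys g\<close>, and the
  monomial \<open>c x^\<eta>\<close> is \<open>Poly_Mapping.single \<eta> c\<close>.
\<close>

type_synonym 'x pterm = "'x \<Rightarrow>\<^sub>0 nat"
type_synonym ('x, 'a) mpoly = "'x pterm \<Rightarrow>\<^sub>0 'a"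

definition term_dvd :: "'x pterm \<Rightarrow> 'x pterm \<Rightarrow> bool"
  where "term_dvd s t \<longleftrightarrow> (\<exists>u. t = s + u)"

definition term_lcm :: "'x::finite pterm \<Rightarrow> 'x pterm \<Rightarrow> 'x pterm"
  where "term_lcm s t = Abs_poly_mapping (\<lambda>i. max (Poly_Mapping.lookup s i) (Poly_Mapping.lookup t i))"

lemma lookup_term_lcm:
  "Poly_Mapping.lookup (term_lcm s t) i =
    max (Poly_Mapping.lookup s i) (Poly_Mapping.lookup t i)"
  by (simp add: term_lcm_def)

lemma term_lcm_commute: "term_lcm s t = term_lcm t s"
  by (simp add: term_lcm_def max.commute)

lemma term_lcm_minus_plus:
  "term_lcm s t - s + s = term_lcm s t" "term_lcm s t - t + t = term_lcm s t"
  by (auto intro!: poly_mapping_eqI simp: Poly_Mapping.lookup_add Poly_Mapping.lookup_minus lookup_term_lcm)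

definition semigroup_ideal :: "'x pterm set \<Rightarrow> bool"
  where "semigroup_ideal I \<longleftrightarrow> (\<forall>s\<in>I. \<forall>t. s + t \<in> I)"

definition order_ideal :: "'x pterm set \<Rightarrow> bool"
  where "order_ideal T \<longleftrightarrow> (\<exists>I. semigroup_ideal I \<and> T = - I)"

definition poly_ideal :: "('x, 'a::comm_ring_1) mpoly set \<Rightarrow> ('x, 'a) mpoly set"
  where "poly_ideal V = module.span (*) V"

definition lin_span :: "('x, 'a::field) mpoly set \<Rightarrow> ('x, 'a) mpoly set"
  where "lin_span V = module.span (\<lambda>c p. Poly_Mapping.single 0 c * p) V"

lemma module_poly_mult: "module ((*) :: ('x, 'a::comm_ring_1) mpoly \<Rightarrow> _)"
  by unfold_locales (simp_all add: algebra_simps)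

lemma vector_space_poly_scale:
  "vector_space (\<lambda>(c::'a::field) (p::('x, 'a) mpoly). Poly_Mapping.single 0 c * p)"
  by unfold_locales
    (simp_all add: algebra_simps single_add mult_single flip: mult.assoc)

text \<open>
  The fields of a reduction structure are \<open>M\<close>, \<open>\<lambda>\<close> and \<open>\<tau>\<close>; the families
  \<open>\<lambda>\<close> and \<open>\<tau>\<close> are relevant only on \<open>M\<close>.
\<close>

record 'x rstruct =
  rs_M :: "'x pterm set"
  rs_lam :: "'x pterm \<Rightarrow> 'x pterm set"
  rs_tau :: "'x pterm \<Rightarrow> 'x pterm set"

definition cone :: "'x rstruct \<Rightarrow> 'x pterm \<Rightarrow> 'x pterm set"
  where "cone J \<alpha> = {\<alpha> + \<eta> | \<eta>. \<eta> \<in> rs_tau J \<alpha>}"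

definition rs_J :: "'x rstruct \<Rightarrow> 'x pterm set"
  where "rs_J J = semigroup_ideal hull rs_M J"

definition rs_N :: "'x rstruct \<Rightarrow> 'x pterm set"
  where "rs_N J = - rs_J J"

text \<open>
  The sets \<open>\<tau>\<^sub>\<alpha>\<close> are nonempty, as usual for order ideals; equivalently \<open>1 \<in> \<tau>\<^sub>\<alpha>\<close>, i.e.
  \<open>x^\<alpha> \<in> cone (x^\<alpha>)\<close>. Without this convention neither noetherianity nor an order would
  constrain the tail of a head term whose cone is empty.
\<close>

definition reduction_structure :: "'x rstruct \<Rightarrow> bool"
  where "reduction_structure J \<longleftrightarrow>
    finite (rs_M J) \<and>
    (\<forall>\<alpha>\<in>rs_M J. order_ideal (rs_tau J \<alpha>) \<and> rs_tau J \<alpha> \<noteq> {}) \<and>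
    (\<Union>\<alpha>\<in>rs_M J. cone J \<alpha>) = rs_J J \<and>
    (\<forall>\<alpha>\<in>rs_M J. rs_lam J \<alpha> \<subseteq> - cone J \<alpha> \<and> finite (rs_lam J \<alpha>))"

definition disjoint_cones :: "'x rstruct \<Rightarrow> bool"
  where "disjoint_cones J \<longleftrightarrow>
    (\<forall>\<alpha>\<in>rs_M J. \<forall>\<beta>\<in>rs_M J. \<alpha> \<noteq> \<beta> \<longrightarrow> cone J \<alpha> \<inter> cone J \<beta> = {})"

text \<open>A marked set is given as a family \<open>f\<close>, of which only the members \<open>f \<alpha>\<close> with
  \<open>\<alpha> \<in> rs_M J\<close> matter.\<close>

definition marked_set :: "'x rstruct \<Rightarrow> ('x pterm \<Rightarrow> ('x, 'a::field) mpoly) \<Rightarrow> bool"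
  where "marked_set J f \<longleftrightarrow>
    (\<forall>\<alpha>\<in>rs_M J. Poly_Mapping.lookup (f \<alpha>) \<alpha> = 1 \<and> Poly_Mapping.keys (f \<alpha> - Poly_Mapping.single \<alpha> 1) \<subseteq> rs_lam J \<alpha>)"

definition direct_sum_UNIV :: "('x, 'a::field) mpoly set \<Rightarrow> ('x, 'a) mpoly set \<Rightarrow> bool"
  where "direct_sum_UNIV U V \<longleftrightarrow> {u + v | u v. u \<in> U \<and> v \<in> V} = UNIV \<and> U \<inter> V = {0}"

definition marked_basis :: "'x rstruct \<Rightarrow> ('x pterm \<Rightarrow> ('x, 'a::field) mpoly) \<Rightarrow> bool"
  where "marked_basis J f \<longleftrightarrow> marked_set J f \<and>
    direct_sum_UNIV (poly_ideal (f ` rs_M J))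
      (lin_span ((\<lambda>t. Poly_Mapping.single t 1) ` rs_N J))"

text \<open>\<open>spoly f \<alpha>' \<alpha>\<close> is \<open>S(f\<^bsub>\<alpha>'\<^esub>, f\<^bsub>\<alpha>\<^esub>)\<close>. Subtraction of exponent vectors is pointwise and
  does not truncate here, by \<open>term_lcm_minus_plus\<close>.\<close>

definition spoly ::
    "('x::finite pterm \<Rightarrow> ('x, 'a::field) mpoly) \<Rightarrow> 'x pterm \<Rightarrow> 'x pterm \<Rightarrow> ('x, 'a) mpoly"
  where "spoly f \<alpha>' \<alpha> =
    Poly_Mapping.single (term_lcm \<alpha> \<alpha>' - \<alpha>) 1 * f \<alpha> -
    Poly_Mapping.single (term_lcm \<alpha> \<alpha>' - \<alpha>') 1 * f \<alpha>'"

definition red1 :: "'x rstruct \<Rightarrow> ('x pterm \<Rightarrow> ('x, 'a::field) mpoly) \<Rightarrow>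
    ('x, 'a) mpoly \<Rightarrow> ('x, 'a) mpoly \<Rightarrow> bool"
  where "red1 J f g h \<longleftrightarrow>
    (\<exists>\<gamma>\<in>Poly_Mapping.keys g. \<exists>\<alpha>\<in>rs_M J. \<exists>\<eta>\<in>rs_tau J \<alpha>.
      \<gamma> = \<alpha> + \<eta> \<and> h = g - Poly_Mapping.single \<eta> (Poly_Mapping.lookup g \<gamma>) * f \<alpha>)"

definition reduces_final :: "'x rstruct \<Rightarrow> ('x pterm \<Rightarrow> ('x, 'a::field) mpoly) \<Rightarrow>
    ('x, 'a) mpoly \<Rightarrow> ('x, 'a) mpoly \<Rightarrow> bool"
  where "reduces_final J f g l \<longleftrightarrow> (red1 J f)\<^sup>*\<^sup>* g l \<and> Poly_Mapping.keys l \<subseteq> rs_N J"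

text \<open>The marked sets range over polynomials with coefficients in the given field \<open>'a\<close>.\<close>

definition noetherian_rs :: "'a::field itself \<Rightarrow> 'x rstruct \<Rightarrow> bool"
  where "noetherian_rs _ J \<longleftrightarrow>
    (\<forall>f :: 'x pterm \<Rightarrow> ('x, 'a) mpoly. marked_set J f \<longrightarrow>
      \<not> (\<exists>g :: nat \<Rightarrow> ('x, 'a) mpoly. \<forall>i. red1 J f (g i) (g (Suc i))))"

definition well_founded_order :: "('x pterm \<Rightarrow> 'x pterm \<Rightarrow> bool) \<Rightarrow> bool"
  where "well_founded_order prec \<longleftrightarrow> irreflp prec \<and> transp prec \<and> wfp prec"

definition ordered_by :: "'x rstruct \<Rightarrow> ('x pterm \<Rightarrow> 'x pterm \<Rightarrow> bool) \<Rightarrow> bool"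
  where "ordered_by J prec \<longleftrightarrow> well_founded_order prec \<and>
    (\<forall>\<alpha>\<in>rs_M J. \<forall>\<gamma>\<in>rs_lam J \<alpha>. \<forall>\<eta>\<in>rs_tau J \<alpha>. prec (\<gamma> + \<eta>) (\<alpha> + \<eta>))"

end

theory Submission
  imports Defs
begin

text \<open>
  Let \<open>W\<close> be the linear span of the multiples \<open>x^\<eta> f\<^sub>\<alpha>\<close> with \<open>\<eta> \<in> \<tau>\<^sub>\<alpha>\<close>, which are the polynomials that
  one-step reductions subtract. Full reduction of arbitrary polynomials gives \<open>\<P> = W + \<langle>N(J)\<rangle>\<close>
  (\<open>cone_span_plus_normal\<close>). The sum is direct: disjoint cones make the head terms \<open>\<alpha> + \<eta>\<close> of these
  multiples distinct, and in a linear combination of them a head that is maximal for the order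
  cannot cancel (\<open>cone_span_Int_normal\<close>). Since \<open>W\<close> lies in the ideal \<open>(F)\<close>, the family is a marked
  basis as soon as \<open>(F) \<subseteq> W\<close>, that is, as soon as \<open>x^\<eta> f\<^sub>\<beta> \<in> W\<close> for \<^emph>\<open>all\<close> exponents \<open>\<eta>\<close>.

  This is shown by well-founded induction on the head \<open>t = \<beta> + \<eta>\<close>. The term \<open>t\<close> lies in the cone of
  some \<open>\<beta>'\<close>, say \<open>t = \<beta>' + \<eta>'\<close> with \<open>x^\<eta>' f\<^sub>\<beta>' \<in> W\<close>, so it suffices that the difference
  \<open>x^\<eta> f\<^sub>\<beta> - x^\<eta>' f\<^sub>\<beta>'\<close>, a multiple of an S-polynomial, is a combination of multiples of members of \<open>F\<close>
  with heads strictly below \<open>t\<close> (\<open>ideal_subset_cone_span\<close>). Such a representation exists whenever the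
  S-polynomial reduces to \<open>0\<close>, because the order is invariant under multiplication: all terms of the
  S-polynomial are below the lcm, reductions stay below it, and multiplying by a term preserves the
  inequalities (\<open>spoly_syzygy\<close>).

  The criterion on triples results from working with these representations instead of with
  reductions: for a common multiple \<open>t\<close> of \<open>\<alpha>'\<close>, \<open>\<alpha>\<close>, \<open>\<alpha>''\<close>, the differences for \<open>(\<alpha>', \<alpha>)\<close> and
  \<open>(\<alpha>, \<alpha>'')\<close> add up to the one for \<open>(\<alpha>', \<alpha>'')\<close>, and representations below \<open>t\<close> can be added
  (\<open>syzygy_below_trans\<close>). The sum for \<open>(\<alpha>', \<alpha>'')\<close> need not come from a reduction of
  \<open>S(f\<^sub>\<alpha>', f\<^sub>\<alpha>'')\<close>, but it serves the induction equally well.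

  Conversely, an S-polynomial lies in \<open>(F)\<close>, hence so does each of its normal forms, and for a marked
  basis the only element of \<open>(F)\<close> supported in \<open>N(J)\<close> is \<open>0\<close>.
\<close>

section \<open>Linear spans and ideals of polynomials\<close>

interpretation lin: vector_space "\<lambda>(c::'a::field) (p::('x, 'a) mpoly). Poly_Mapping.single 0 c * p"
  by (rule vector_space_poly_scale)

interpretation ideal: module "(*) :: ('x, 'a::comm_ring_1) mpoly \<Rightarrow> _"
  by (rule module_poly_mult)

(* For scaling by ring multiplication this is associativity read from right to left, which would
   make the simplifier loop with mult.assoc. *)
declare ideal.scale_scale [simp del]

abbreviation xpow :: "'x pterm \<Rightarrow> ('x, 'a::field) mpoly"
  where "xpow t \<equiv> Poly_Mapping.single t 1"

lemma single_eq_scale: "Poly_Mapping.single t c = Poly_Mapping.single 0 c * xpow t"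
  by (simp add: mult_single)

lemma xpow_mult_xpow: "xpow s * (xpow t * p) = xpow (s + t) * (p :: ('x, 'a::field) mpoly)"
  by (simp add: mult_single flip: mult.assoc)

lemma lookup_scale:
  "Poly_Mapping.lookup (Poly_Mapping.single 0 c * q) t = (c::'a::field) * Poly_Mapping.lookup q t"
  by (simp add: Poly_Mapping.map.rep_eq when_def flip: mult_map_scale_conv_mult)

lemma poly_eq_sum_keys:
  "g = (\<Sum>t\<in>Poly_Mapping.keys g. Poly_Mapping.single t (Poly_Mapping.lookup g t))"
  by (rule poly_mapping_eqI) (auto simp: lookup_sum lookup_single when_def in_keys_iff)

lemma mult_in_lin_span:
  assumes "p \<in> lin_span B" and "\<And>b. b \<in> B \<Longrightarrow> m * b \<in> lin_span C"
  shows "m * p \<in> lin_span C"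
  using assms(1) unfolding lin_span_def
proof (induction rule: lin.span_induct_alt)
  case base
  show ?case by (simp add: lin.span_zero)
next
  case (step c x y)
  have "m * (Poly_Mapping.single 0 c * x + y) = Poly_Mapping.single 0 c * (m * x) + m * y"
    by (simp add: algebra_simps)
  with step assms(2)[of x] show ?case
    by (simp add: lin.span_add lin.span_scale lin_span_def)
qed

text \<open>Monomials span the polynomial ring, so their multiples determine all multiples.\<close>

lemma poly_mult_in_lin_span:
  assumes "\<And>t. xpow t * b \<in> lin_span C"
  shows "q * b \<in> lin_span C"
proof -
  have "q * b = (\<Sum>t\<in>Poly_Mapping.keys q.
      Poly_Mapping.single 0 (Poly_Mapping.lookup q t) * (xpow t * b))"
    by (subst poly_eq_sum_keys[of q], subst single_eq_scale)
       (simp only: sum_distrib_right mult.assoc)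
  also have "\<dots> \<in> lin_span C"
    using assms unfolding lin_span_def by (intro lin.span_sum lin.span_scale)
  finally show ?thesis .
qed

lemma poly_ideal_subset_lin_span:
  assumes "\<And>b t. b \<in> B \<Longrightarrow> xpow t * b \<in> lin_span C"
  shows "poly_ideal B \<subseteq> lin_span C"
proof
  fix p assume "p \<in> poly_ideal B"
  then show "p \<in> lin_span C"
    unfolding poly_ideal_def
  proof (induction rule: ideal.span_induct_alt)
    case base
    show ?case by (simp add: lin_span_def lin.span_zero)
  next
    case (step q b y)
    then have "q * b \<in> lin_span C"
      using assms by (meson poly_mult_in_lin_span)
    with step show ?case by (simp add: lin_span_def lin.span_add)
  qed
qed

lemma lin_span_monomials_iff:
  "p \<in> lin_span (xpow ` N) \<longleftrightarrow> Poly_Mapping.keys p \<subseteq> N"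
proof
  assume "p \<in> lin_span (xpow ` N)"
  then show "Poly_Mapping.keys p \<subseteq> N"
    unfolding lin_span_def
  proof (induction rule: lin.span_induct_alt)
    case (step c x y)
    then have "Poly_Mapping.keys (Poly_Mapping.single 0 c * x) \<subseteq> N"
      by (auto simp: mult_single split: if_splits)
    with step show ?case
      using keys_add[of "Poly_Mapping.single 0 c * x" y] by blast
  qed simp
next
  assume N: "Poly_Mapping.keys p \<subseteq> N"
  have "p = (\<Sum>t\<in>Poly_Mapping.keys p. Poly_Mapping.single 0 (Poly_Mapping.lookup p t) * xpow t)"
    by (simp only: flip: single_eq_scale poly_eq_sum_keys)
  also have "\<dots> \<in> lin_span (xpow ` N)"
    unfolding lin_span_def
  proof (rule lin.span_sum)
    fix t assume "t \<in> Poly_Mapping.keys p"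
    with N have "xpow t \<in> lin.span (xpow ` N)"
      by (auto intro: lin.span_base)
    then show "Poly_Mapping.single 0 (Poly_Mapping.lookup p t) * xpow t \<in> lin.span (xpow ` N)"
      by (rule lin.span_scale)
  qed
  finally show "p \<in> lin_span (xpow ` N)" .
qed

lemma lookup_term_lcm_le:
  assumes "term_dvd s t" "term_dvd s' t"
  shows "Poly_Mapping.lookup (term_lcm s s') i \<le> Poly_Mapping.lookup t i"
proof -
  obtain u u' where "t = s + u" "t = s' + u'"
    using assms unfolding term_dvd_def by blast
  then have "Poly_Mapping.lookup t i = Poly_Mapping.lookup s i + Poly_Mapping.lookup u i"
    "Poly_Mapping.lookup t i = Poly_Mapping.lookup s' i + Poly_Mapping.lookup u' i"
    by (metis lookup_add)+
  then show ?thesis by (simp add: lookup_term_lcm)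
qed

section \<open>Marked sets and reduction\<close>

locale marked_rs =
  fixes J :: "'x rstruct" and f :: "'x pterm \<Rightarrow> ('x, 'a::field) mpoly"
  assumes rs: "reduction_structure J" and marked: "marked_set J f"
begin

text \<open>The set \<open>D\<close> restricts the head terms of the multiples; it serves to keep track of the heads that
  occur when only terms from \<open>D\<close> are reduced.\<close>

definition cone_span :: "'x pterm set \<Rightarrow> ('x, 'a) mpoly set"
  where "cone_span D = lin_span {xpow \<eta> * f \<beta> | \<beta> \<eta>. \<beta> \<in> rs_M J \<and> \<eta> \<in> rs_tau J \<beta> \<and> \<beta> + \<eta> \<in> D}"

definition marked_ideal :: "('x, 'a) mpoly set"
  where "marked_ideal = poly_ideal (f ` rs_M J)"

lemma tau_closed:
  assumes "\<beta> \<in> rs_M J" "\<eta> + \<epsilon> \<in> rs_tau J \<beta>"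
  shows "\<eta> \<in> rs_tau J \<beta>"
  using assms rs unfolding reduction_structure_def order_ideal_def semigroup_ideal_def
  by (metis ComplD ComplI)

lemma zero_in_tau:
  assumes "\<beta> \<in> rs_M J"
  shows "0 \<in> rs_tau J \<beta>"
proof -
  have "rs_tau J \<beta> \<noteq> {}"
    using assms rs by (auto simp: reduction_structure_def)
  then show ?thesis
    using tau_closed[OF assms, of 0] by auto
qed

lemma multiple_in_some_cone:
  assumes "\<beta> \<in> rs_M J"
  obtains \<beta>' where "\<beta>' \<in> rs_M J" "\<beta> + \<eta> \<in> cone J \<beta>'"
proof -
  have "semigroup_ideal (rs_J J)"
    unfolding rs_J_def by (rule hull_in) (auto simp: semigroup_ideal_def)
  moreover have "\<beta> \<in> rs_J J"
    using assms unfolding rs_J_def by (rule hull_inc)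
  ultimately have "\<beta> + \<eta> \<in> rs_J J"
    by (simp add: semigroup_ideal_def)
  then show ?thesis
    using that rs unfolding reduction_structure_def by blast
qed

lemma keys_tail:
  assumes "\<beta> \<in> rs_M J"
  shows "Poly_Mapping.keys (xpow \<eta> * f \<beta> - xpow (\<beta> + \<eta>)) \<subseteq> {\<gamma> + \<eta> | \<gamma>. \<gamma> \<in> rs_lam J \<beta>}"
proof -
  have "xpow \<eta> * f \<beta> - xpow (\<beta> + \<eta>) = xpow \<eta> * (f \<beta> - xpow \<beta>)"
    by (simp add: right_diff_distrib mult_single add.commute)
  moreover have "Poly_Mapping.keys (f \<beta> - xpow \<beta>) \<subseteq> rs_lam J \<beta>"
    using assms marked by (auto simp: marked_set_def)
  ultimately show ?thesis
    using keys_mult[of "xpow \<eta> :: ('x, 'a) mpoly" "f \<beta> - xpow \<beta>"]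
    by (fastforce simp: add.commute)
qed

lemma multiple_in_ideal: "\<beta> \<in> rs_M J \<Longrightarrow> q * f \<beta> \<in> marked_ideal"
  unfolding marked_ideal_def poly_ideal_def by (intro ideal.span_scale ideal.span_base) auto

lemma cone_span_subset_ideal: "cone_span D \<subseteq> marked_ideal"
proof
  fix p assume "p \<in> cone_span D"
  then show "p \<in> marked_ideal"
    unfolding cone_span_def lin_span_def
  proof (induction rule: lin.span_induct_alt)
    case base
    show ?case by (simp add: marked_ideal_def poly_ideal_def ideal.span_zero)
  next
    case (step c x y)
    then have "Poly_Mapping.single 0 c * x \<in> marked_ideal"
      by (auto intro: multiple_in_ideal simp flip: mult.assoc)
    with step show ?case
      by (simp add: marked_ideal_def poly_ideal_def ideal.span_add)
  qed
qed

lemma normal_form_exists: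
  assumes "noetherian_rs TYPE('a) J"
  obtains l where "reduces_final J f g l"
proof -
  have "wf {(h, g). red1 J f g h}"
    using assms marked unfolding noetherian_rs_def wf_iff_no_infinite_down_chain by simp
  then have "\<exists>l. reduces_final J f g l"
  proof (induction g rule: wf_induct_rule)
    case (less g)
    show ?case
    proof (cases "Poly_Mapping.keys g \<subseteq> rs_N J")
      case True
      then show ?thesis by (auto simp: reduces_final_def)
    next
      case False
      then obtain t where t: "t \<in> Poly_Mapping.keys g" "t \<in> rs_J J"
        by (auto simp: rs_N_def)
      moreover have "rs_J J = (\<Union>\<alpha>\<in>rs_M J. cone J \<alpha>)"
        using rs by (simp add: reduction_structure_def)
      ultimately obtain \<beta> \<eta> where "\<beta> \<in> rs_M J" "\<eta> \<in> rs_tau J \<beta>" "t = \<beta> + \<eta>"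
        by (auto simp: cone_def)
      with t have step: "red1 J f g (g - Poly_Mapping.single \<eta> (Poly_Mapping.lookup g t) * f \<beta>)"
        unfolding red1_def by blast
      with less obtain l
        where "reduces_final J f (g - Poly_Mapping.single \<eta> (Poly_Mapping.lookup g t) * f \<beta>) l"
        by blast
      with step show ?thesis
        unfolding reduces_final_def by (meson converse_rtranclp_into_rtranclp)
    qed
  qed
  with that show ?thesis by blast
qed

text \<open>The closure condition holds for \<open>D = UNIV\<close>, which gives the decomposition of \<open>\<P>\<close>, and for the set
  of terms below a given one, which bounds the heads used in reducing an S-polynomial.\<close>

lemma reduction_in_cone_span:
  assumes "(red1 J f)\<^sup>*\<^sup>* g h" "Poly_Mapping.keys g \<subseteq> D"
    and closed: "\<And>\<beta> \<gamma> \<eta>. \<lbrakk>\<beta> \<in> rs_M J; \<gamma> \<in> rs_lam J \<beta>; \<eta> \<in> rs_tau J \<beta>; \<beta> + \<eta> \<in> D\<rbrakk> \<Longrightarrow> \<gamma> + \<eta> \<in> D"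
  shows "g - h \<in> cone_span D \<and> Poly_Mapping.keys h \<subseteq> D"
  using assms(1,2)
proof (induction rule: rtranclp_induct)
  case base
  then show ?case by (simp add: cone_span_def lin_span_def lin.span_zero)
next
  case (step h k)
  then have IH: "g - h \<in> cone_span D" "Poly_Mapping.keys h \<subseteq> D" by auto
  from step obtain \<beta> \<eta> where *: "\<beta> \<in> rs_M J" "\<eta> \<in> rs_tau J \<beta>" "\<beta> + \<eta> \<in> Poly_Mapping.keys h"
    and k: "k = h - Poly_Mapping.single \<eta> (Poly_Mapping.lookup h (\<beta> + \<eta>)) * f \<beta>"
    unfolding red1_def by blast
  define c where "c = Poly_Mapping.lookup h (\<beta> + \<eta>)"
  have head: "\<beta> + \<eta> \<in> D" using * IH by blast
  have k': "k = h - Poly_Mapping.single 0 c * (xpow \<eta> * f \<beta>)"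
    by (simp add: k c_def mult_single flip: mult.assoc)
  have "xpow \<eta> * f \<beta> \<in> cone_span D"
    unfolding cone_span_def lin_span_def using * head by (intro lin.span_base) blast
  then have "g - h + Poly_Mapping.single 0 c * (xpow \<eta> * f \<beta>) \<in> cone_span D"
    using IH unfolding cone_span_def lin_span_def by (intro lin.span_add lin.span_scale)
  then have "g - k \<in> cone_span D"
    by (simp only: k' diff_diff_eq2 diff_add_eq)
  moreover have "Poly_Mapping.keys (xpow \<eta> * f \<beta>) \<subseteq> D"
  proof -
    have "Poly_Mapping.keys (xpow \<eta> * f \<beta> - xpow (\<beta> + \<eta>)) \<subseteq> D"
      using keys_tail[OF *(1)] closed * head by blast
    then show ?thesis
      using keys_add[of "xpow \<eta> * f \<beta> - xpow (\<beta> + \<eta>)" "xpow (\<beta> + \<eta>)"] head by auto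
  qed
  moreover have "Poly_Mapping.keys (Poly_Mapping.single 0 c * p) \<subseteq> Poly_Mapping.keys p"
    for p :: "('x, 'a) mpoly"
    by (auto simp: in_keys_iff lookup_scale)
  ultimately show ?case
    using IH keys_diff[of h "Poly_Mapping.single 0 c * (xpow \<eta> * f \<beta>)"] unfolding k' by blast
qed

lemma cone_span_plus_normal:
  assumes "noetherian_rs TYPE('a) J"
  obtains w l where "g = w + l" "w \<in> cone_span UNIV" "Poly_Mapping.keys l \<subseteq> rs_N J"
proof -
  obtain l where l: "reduces_final J f g l"
    by (rule normal_form_exists[OF assms])
  have "g - l \<in> cone_span UNIV"
    using l reduction_in_cone_span[of g l UNIV] by (simp add: reduces_final_def)
  with l that[of "g - l" l] show ?thesis by (simp add: reduces_final_def)
qed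

text \<open>A normal form of an element of the ideal is again in the ideal, so it is \<open>0\<close> when the ideal meets
  \<open>\<langle>N(J)\<rangle>\<close> trivially.\<close>

lemma marked_basis_reduces_to_0:
  assumes "noetherian_rs TYPE('a) J" "marked_basis J f" "p \<in> marked_ideal"
  shows "reduces_final J f p 0"
proof -
  obtain l where l: "reduces_final J f p l"
    by (rule normal_form_exists[OF assms(1)])
  have "p - l \<in> marked_ideal"
    using l reduction_in_cone_span[of p l UNIV] cone_span_subset_ideal
    by (auto simp: reduces_final_def)
  with assms(3) have "p - (p - l) \<in> marked_ideal"
    unfolding marked_ideal_def poly_ideal_def by (rule ideal.span_diff)
  moreover have "l \<in> lin_span (xpow ` rs_N J)"
    using l by (simp add: lin_span_monomials_iff reduces_final_def)
  ultimately have "l = 0"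
    using assms(2) unfolding marked_basis_def direct_sum_UNIV_def marked_ideal_def by auto
  with l show ?thesis by simp
qed

end

section \<open>Representations below a term\<close>

locale ordered_marked_rs = marked_rs J f
  for J :: "'x rstruct" and f :: "'x pterm \<Rightarrow> ('x, 'a::field) mpoly" +
  fixes prec :: "'x pterm \<Rightarrow> 'x pterm \<Rightarrow> bool"
  assumes ord: "ordered_by J prec"
begin

lemma prec_irrefl: "\<not> prec t t"
  and prec_trans: "prec r s \<Longrightarrow> prec s t \<Longrightarrow> prec r t"
  and wfp_prec: "wfp prec"
  and prec_tail: "\<lbrakk>\<beta> \<in> rs_M J; \<gamma> \<in> rs_lam J \<beta>; \<eta> \<in> rs_tau J \<beta>\<rbrakk> \<Longrightarrow> prec (\<gamma> + \<eta>) (\<beta> + \<eta>)"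
  using ord
  by (auto simp: ordered_by_def well_founded_order_def irreflp_def dest: transpD)

lemma lookup_cone_multiple:
  assumes "\<beta> \<in> rs_M J" "\<eta> \<in> rs_tau J \<beta>" "\<not> prec t (\<beta> + \<eta>)"
  shows "Poly_Mapping.lookup (xpow \<eta> * f \<beta>) t = (if t = \<beta> + \<eta> then 1 else 0)"
proof -
  have "t \<notin> Poly_Mapping.keys (xpow \<eta> * f \<beta> - xpow (\<beta> + \<eta>))"
    using keys_tail[OF assms(1)] prec_tail[OF assms(1) _ assms(2)] assms(3) by blast
  then show ?thesis
    by (simp add: in_keys_iff lookup_minus lookup_single when_def split: if_splits)
qed

text \<open>A maximal head in a nontrivial combination of cone multiples occurs in no other tail, and by
  disjointness of the cones it is the head of only one multiple. So it survives, and it lies in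
  \<open>J\<close>.\<close>

lemma cone_span_Int_normal:
  assumes disj: "disjoint_cones J" and p: "p \<in> cone_span D" "Poly_Mapping.keys p \<subseteq> rs_N J"
  shows "p = 0"
proof -
  define B where "B = {xpow \<eta> * f \<beta> | \<beta> \<eta>. \<beta> \<in> rs_M J \<and> \<eta> \<in> rs_tau J \<beta> \<and> \<beta> + \<eta> \<in> D}"
  obtain c where fin: "finite {b. c b \<noteq> 0}" and sub: "{b. c b \<noteq> 0} \<subseteq> B"
    and pc: "p = (\<Sum>b | c b \<noteq> 0. Poly_Mapping.single 0 (c b) * b)"
    using p(1) unfolding cone_span_def lin_span_def lin.span_alt B_def[symmetric] by blast
  have "\<forall>b\<in>B. \<exists>\<beta> \<eta>. b = xpow \<eta> * f \<beta> \<and> \<beta> \<in> rs_M J \<and> \<eta> \<in> rs_tau J \<beta>"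
    unfolding B_def by blast
  then obtain hd sh where rep: "\<And>b. b \<in> B \<Longrightarrow>
      b = xpow (sh b) * f (hd b) \<and> hd b \<in> rs_M J \<and> sh b \<in> rs_tau J (hd b)"
    by metis
  define head where "head b = hd b + sh b" for b
  have head_cone: "head b \<in> cone J (hd b)" if "b \<in> B" for b
    using rep[OF that] by (auto simp: head_def cone_def)
  have inj: "b = b'" if "b \<in> B" "b' \<in> B" "head b = head b'" for b b'
  proof -
    have "hd b = hd b'"
    proof (rule ccontr)
      assume "hd b \<noteq> hd b'"
      then have "cone J (hd b) \<inter> cone J (hd b') = {}"
        using disj rep that unfolding disjoint_cones_def by blast
      then show False using head_cone[OF that(1)] head_cone[OF that(2)] that(3) by auto
    qed
    with that(3) have "sh b = sh b'" by (simp add: head_def)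
    with \<open>hd b = hd b'\<close> rep that show ?thesis by metis
  qed
  have "{b. c b \<noteq> 0} = {}"
  proof (rule ccontr)
    assume "{b. c b \<noteq> 0} \<noteq> {}"
    moreover have "asymp_on (head ` {b. c b \<noteq> 0}) prec" "transp_on (head ` {b. c b \<noteq> 0}) prec"
      using prec_irrefl prec_trans by (blast intro: asymp_onI transp_onI)+
    ultimately obtain m where m: "c m \<noteq> 0"
      and max: "\<And>b. c b \<noteq> 0 \<Longrightarrow> head b \<noteq> head m \<Longrightarrow> \<not> prec (head m) (head b)"
      using Finite_Set.bex_max_element[of "head ` {b. c b \<noteq> 0}" prec] fin by auto
    have lk: "Poly_Mapping.lookup b (head m) = (if b = m then 1 else 0)" if "c b \<noteq> 0" for b
    proof -
      have B: "b \<in> B" "m \<in> B" using that m sub by auto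
      have "\<not> prec (head m) (head b)"
        using max[OF that] prec_irrefl by metis
      then have "Poly_Mapping.lookup (xpow (sh b) * f (hd b)) (head m) = (if head m = head b then 1 else 0)"
        using lookup_cone_multiple[of "hd b" "sh b" "head m"] rep[OF B(1)] by (simp add: head_def)
      then show ?thesis using rep[OF B(1)] inj[OF B] by auto
    qed
    have "Poly_Mapping.lookup p (head m) = (\<Sum>b | c b \<noteq> 0. if b = m then c b else 0)"
      unfolding pc lookup_sum by (rule sum.cong) (auto simp: lookup_scale lk)
    also have "\<dots> = c m" using m fin by simp
    finally have "head m \<in> Poly_Mapping.keys p" using m by (simp add: in_keys_iff)
    moreover have "head m \<in> rs_J J"
      using head_cone[of m] rep[of m] m sub rs unfolding reduction_structure_def by blast
    ultimately show False using p(2) by (auto simp: rs_N_def)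
  qed
  then show ?thesis using pc by simp
qed

text \<open>Unlike in \<open>cone_span\<close>, the shifts \<open>\<eta>\<close> are arbitrary: this is what makes these spaces stable under
  multiplication by terms.\<close>

definition below :: "'x pterm \<Rightarrow> ('x, 'a) mpoly set"
  where "below t = lin_span {xpow \<eta> * f \<beta> | \<beta> \<eta>. \<beta> \<in> rs_M J \<and> prec (\<beta> + \<eta>) t}"

lemma cone_span_subset_below: "cone_span {s. prec s t} \<subseteq> below t"
  unfolding cone_span_def below_def lin_span_def by (rule lin.span_mono) auto

end

text \<open>Invariance is needed for arbitrary terms, since multiples \<open>x^\<eta> f\<^sub>\<beta>\<close> with \<open>\<eta> \<notin> \<tau>\<^sub>\<beta>\<close> enter
  S-polynomials, and \<open>ordered_by\<close> says nothing about their tails.\<close>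

locale invariant_marked_rs = ordered_marked_rs J f prec
  for J :: "'x::finite rstruct" and f :: "'x pterm \<Rightarrow> ('x, 'a::field) mpoly" and prec +
  assumes prec_add: "prec s t \<Longrightarrow> prec (s + \<epsilon>) (t + \<epsilon>)"
begin

lemma below_mult_xpow:
  assumes "p \<in> below t"
  shows "xpow \<epsilon> * p \<in> below (t + \<epsilon>)"
  using assms unfolding below_def
proof (rule mult_in_lin_span)
  fix b assume "b \<in> {xpow \<eta> * f \<beta> | \<beta> \<eta>. \<beta> \<in> rs_M J \<and> prec (\<beta> + \<eta>) t}"
  then obtain \<beta> \<eta> where "b = xpow \<eta> * f \<beta>" "\<beta> \<in> rs_M J" "prec (\<beta> + \<eta>) t" by blast
  moreover from this have "xpow \<epsilon> * b = xpow (\<eta> + \<epsilon>) * f \<beta>"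
    by (simp only: xpow_mult_xpow add.commute)
  moreover have "prec (\<beta> + (\<eta> + \<epsilon>)) (t + \<epsilon>)"
    using prec_add[OF \<open>prec (\<beta> + \<eta>) t\<close>] by (simp add: add.assoc)
  ultimately show "xpow \<epsilon> * b \<in> lin_span {xpow \<eta> * f \<beta> | \<beta> \<eta>. \<beta> \<in> rs_M J \<and> prec (\<beta> + \<eta>) (t + \<epsilon>)}"
    unfolding lin_span_def by (intro lin.span_base) blast
qed

text \<open>The combination of \<open>f\<^sub>\<beta>\<close> and \<open>f\<^sub>\<beta>'\<close> whose heads cancel at \<open>t\<close>, a multiple of the S-polynomial when \<open>t\<close>
  is a common multiple of \<open>\<beta>\<close> and \<open>\<beta>'\<close>; otherwise the subtractions truncate and the value is
  meaningless. Allowing any \<open>t\<close> makes differences for several pairs comparable at the same \<open>t\<close>.\<close>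

definition syzygy :: "'x pterm \<Rightarrow> 'x pterm \<Rightarrow> 'x pterm \<Rightarrow> ('x, 'a) mpoly"
  where "syzygy \<beta> \<beta>' t = xpow (t - \<beta>) * f \<beta> - xpow (t - \<beta>') * f \<beta>'"

lemma spoly_eq_syzygy: "spoly f \<beta>' \<beta> = syzygy \<beta> \<beta>' (term_lcm \<beta> \<beta>')"
  by (simp add: spoly_def syzygy_def)

lemma syzygy_below_sym: "syzygy \<beta> \<beta>' t \<in> below t \<Longrightarrow> syzygy \<beta>' \<beta> t \<in> below t"
  unfolding below_def lin_span_def syzygy_def by (drule lin.span_neg) simp

lemma syzygy_below_trans:
  assumes "syzygy \<beta> \<beta>' t \<in> below t" "syzygy \<beta>' \<beta>'' t \<in> below t"
  shows "syzygy \<beta> \<beta>'' t \<in> below t"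
proof -
  have "syzygy \<beta> \<beta>'' t = syzygy \<beta> \<beta>' t + syzygy \<beta>' \<beta>'' t"
    by (simp add: syzygy_def)
  with assms show ?thesis
    unfolding below_def lin_span_def by (simp add: lin.span_add)
qed

lemma syzygy_below_multiple:
  assumes "syzygy \<beta> \<beta>' (term_lcm \<beta> \<beta>') \<in> below (term_lcm \<beta> \<beta>')"
    and "term_dvd \<beta> t" "term_dvd \<beta>' t"
  shows "syzygy \<beta> \<beta>' t \<in> below t"
proof -
  define m \<epsilon> where "m = term_lcm \<beta> \<beta>'" and "\<epsilon> = t - m"
  have le: "Poly_Mapping.lookup m i \<le> Poly_Mapping.lookup t i" for i
    unfolding m_def using assms(2,3) by (rule lookup_term_lcm_le)
  have t: "t = m + \<epsilon>"
    by (rule poly_mapping_eqI) (simp add: \<epsilon>_def lookup_add lookup_minus le)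
  have "t - \<beta> = \<epsilon> + (m - \<beta>)" "t - \<beta>' = \<epsilon> + (m - \<beta>')"
    by (auto intro!: poly_mapping_eqI simp: t m_def lookup_add lookup_minus lookup_term_lcm)
  then have "syzygy \<beta> \<beta>' t = xpow \<epsilon> * syzygy \<beta> \<beta>' m"
    by (simp add: syzygy_def right_diff_distrib xpow_mult_xpow)
  then show ?thesis
    using below_mult_xpow[of "syzygy \<beta> \<beta>' m" m \<epsilon>] assms(1) by (simp add: t flip: m_def)
qed

text \<open>The two heads of an S-polynomial cancel and only tail terms remain, all of them below the
  lcm.\<close>

lemma spoly_keys_below:
  assumes "\<beta> \<in> rs_M J" "\<beta>' \<in> rs_M J"
  shows "Poly_Mapping.keys (spoly f \<beta>' \<beta>) \<subseteq> {s. prec s (term_lcm \<beta> \<beta>')}"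
proof -
  let ?m = "term_lcm \<beta> \<beta>'"
  have tail: "Poly_Mapping.keys (xpow (?m - \<delta>) * f \<delta> - xpow ?m) \<subseteq> {s. prec s ?m}"
    if "\<delta> \<in> rs_M J" and m: "?m = \<delta> + (?m - \<delta>)" for \<delta>
  proof -
    have "prec (\<gamma> + (?m - \<delta>)) ?m" if "\<gamma> \<in> rs_lam J \<delta>" for \<gamma>
    proof -
      have "prec \<gamma> \<delta>"
        using prec_tail[OF \<open>\<delta> \<in> rs_M J\<close> that zero_in_tau[OF \<open>\<delta> \<in> rs_M J\<close>]] by simp
      then show ?thesis using prec_add m by metis
    qed
    moreover have "Poly_Mapping.keys (xpow (?m - \<delta>) * f \<delta> - xpow ?m)
        \<subseteq> {\<gamma> + (?m - \<delta>) | \<gamma>. \<gamma> \<in> rs_lam J \<delta>}"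
      using keys_tail[OF \<open>\<delta> \<in> rs_M J\<close>, of "?m - \<delta>"] m by simp
    ultimately show ?thesis by blast
  qed
  have "?m = \<beta> + (?m - \<beta>)" "?m = \<beta>' + (?m - \<beta>')"
    using term_lcm_minus_plus[of \<beta> \<beta>'] by (simp_all add: add.commute)
  then have "Poly_Mapping.keys (xpow (?m - \<beta>) * f \<beta> - xpow ?m) \<subseteq> {s. prec s ?m}"
    "Poly_Mapping.keys (xpow (?m - \<beta>') * f \<beta>' - xpow ?m) \<subseteq> {s. prec s ?m}"
    using tail assms by blast+
  moreover have "spoly f \<beta>' \<beta> =
      (xpow (?m - \<beta>) * f \<beta> - xpow ?m) - (xpow (?m - \<beta>') * f \<beta>' - xpow ?m)"
    by (simp add: spoly_def)
  ultimately show ?thesis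
    using keys_diff by (metis (no_types, lifting) Un_least order_trans)
qed

lemma spoly_syzygy:
  assumes "\<beta> \<in> rs_M J" "\<beta>' \<in> rs_M J" "reduces_final J f (spoly f \<beta>' \<beta>) 0"
    and "term_dvd \<beta> t" "term_dvd \<beta>' t"
  shows "syzygy \<beta> \<beta>' t \<in> below t"
proof -
  let ?D = "{s. prec s (term_lcm \<beta> \<beta>')}"
  have "spoly f \<beta>' \<beta> - 0 \<in> cone_span ?D \<and> Poly_Mapping.keys (0 :: ('x, 'a) mpoly) \<subseteq> ?D"
  proof (rule reduction_in_cone_span)
    show "(red1 J f)\<^sup>*\<^sup>* (spoly f \<beta>' \<beta>) 0"
      using assms(3) by (simp add: reduces_final_def)
    show "Poly_Mapping.keys (spoly f \<beta>' \<beta>) \<subseteq> ?D"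
      using assms(1,2) by (rule spoly_keys_below)
    show "\<gamma> + \<eta> \<in> ?D"
      if "\<delta> \<in> rs_M J" "\<gamma> \<in> rs_lam J \<delta>" "\<eta> \<in> rs_tau J \<delta>" "\<delta> + \<eta> \<in> ?D" for \<delta> \<gamma> \<eta>
      using prec_trans[OF prec_tail[OF that(1-3)]] that(4) by simp
  qed
  then have "syzygy \<beta> \<beta>' (term_lcm \<beta> \<beta>') \<in> below (term_lcm \<beta> \<beta>')"
    using cone_span_subset_below by (auto simp: spoly_eq_syzygy)
  then show ?thesis
    using assms(4,5) by (rule syzygy_below_multiple)
qed

text \<open>By induction on the head, all multiples of members of the family lie in the span of the cone
  multiples. If the head \<open>\<beta> + \<eta>\<close> lies in the cone of \<open>\<beta>'\<close>, then so does \<open>lcm(\<beta>, \<beta>')\<close>, because \<open>\<tau>\<^sub>\<beta>'\<close> is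
  closed under divisors; this is why only such pairs need to be tested.\<close>

lemma ideal_subset_cone_span:
  assumes pairs: "\<And>\<beta> \<beta>'. \<lbrakk>\<beta> \<in> rs_M J; \<beta>' \<in> rs_M J; term_lcm \<beta> \<beta>' \<in> cone J \<beta>'\<rbrakk>
      \<Longrightarrow> syzygy \<beta> \<beta>' (term_lcm \<beta> \<beta>') \<in> below (term_lcm \<beta> \<beta>')"
  shows "marked_ideal \<subseteq> cone_span UNIV"
proof -
  have multiple: "xpow \<eta> * f \<beta> \<in> cone_span UNIV" if "\<beta> \<in> rs_M J" for \<beta> \<eta>
    using that
  proof (induction "\<beta> + \<eta>" arbitrary: \<beta> \<eta> rule: wfp_induct_rule[OF wfp_prec])
    case 1
    define t where "t = \<beta> + \<eta>"
    obtain \<beta>' \<eta>' where \<beta>': "\<beta>' \<in> rs_M J" "\<eta>' \<in> rs_tau J \<beta>'" "t = \<beta>' + \<eta>'"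
      using multiple_in_some_cone[OF 1(2), of \<eta>] unfolding cone_def t_def by blast
    let ?m = "term_lcm \<beta> \<beta>'"
    have dvd: "term_dvd \<beta> t" "term_dvd \<beta>' t"
      unfolding term_dvd_def using \<beta>'(3) t_def by blast+
    have le: "Poly_Mapping.lookup ?m i \<le> Poly_Mapping.lookup t i" for i
      using dvd by (rule lookup_term_lcm_le)
    have "\<eta>' = (?m - \<beta>') + (t - ?m)"
    proof (rule poly_mapping_eqI)
      fix i
      show "Poly_Mapping.lookup \<eta>' i = Poly_Mapping.lookup ((?m - \<beta>') + (t - ?m)) i"
        using le[of i] by (simp add: \<beta>'(3) lookup_add lookup_minus lookup_term_lcm)
    qed
    then have "?m - \<beta>' \<in> rs_tau J \<beta>'"
      using tau_closed[OF \<beta>'(1)] \<beta>'(2) by metis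
    moreover have "?m = \<beta>' + (?m - \<beta>')"
      using term_lcm_minus_plus(2)[of \<beta> \<beta>'] by (simp add: add.commute)
    ultimately have "?m \<in> cone J \<beta>'"
      unfolding cone_def by blast
    then have "syzygy \<beta> \<beta>' t \<in> below t"
      using syzygy_below_multiple[OF pairs[OF 1(2) \<beta>'(1)] dvd] by blast
    moreover have "below t \<subseteq> cone_span UNIV"
      unfolding below_def lin_span_def cone_span_def
    proof (rule lin.span_minimal)
      show "{xpow \<eta> * f \<beta> | \<beta> \<eta>. \<beta> \<in> rs_M J \<and> prec (\<beta> + \<eta>) t} \<subseteq>
          lin.span {xpow \<eta> * f \<beta> | \<beta> \<eta>. \<beta> \<in> rs_M J \<and> \<eta> \<in> rs_tau J \<beta> \<and> \<beta> + \<eta> \<in> UNIV}"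
        using 1(1) unfolding t_def cone_span_def lin_span_def by auto
    qed (rule lin.subspace_span)
    moreover have "xpow \<eta>' * f \<beta>' \<in> cone_span UNIV"
      unfolding cone_span_def lin_span_def using \<beta>' by (intro lin.span_base) auto
    ultimately have "syzygy \<beta> \<beta>' t + xpow \<eta>' * f \<beta>' \<in> cone_span UNIV"
      unfolding cone_span_def lin_span_def by (intro lin.span_add) auto
    moreover have "t - \<beta> = \<eta>" by (simp add: t_def)
    moreover have "t - \<beta>' = \<eta>'" by (simp add: \<beta>'(3))
    ultimately show ?case by (simp add: syzygy_def)
  qed
  then show ?thesis
    unfolding marked_ideal_def cone_span_def by (intro poly_ideal_subset_lin_span) auto
qed

lemma marked_basisI:
  assumes "noetherian_rs TYPE('a) J" "disjoint_cones J" "marked_ideal \<subseteq> cone_span UNIV"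
  shows "marked_basis J f"
proof -
  have "\<exists>u v. g = u + v \<and> u \<in> marked_ideal \<and> v \<in> lin_span (xpow ` rs_N J)" for g :: "('x, 'a) mpoly"
    using cone_span_plus_normal[OF assms(1), of g] cone_span_subset_ideal
    by (metis lin_span_monomials_iff subsetD)
  moreover have "marked_ideal \<inter> lin_span (xpow ` rs_N J) \<subseteq> {0}"
    using cone_span_Int_normal[OF assms(2)] assms(3) by (auto simp: lin_span_monomials_iff)
  moreover have "0 \<in> marked_ideal" "0 \<in> lin_span (xpow ` rs_N J)"
    by (auto simp: marked_ideal_def poly_ideal_def ideal.span_zero lin_span_def lin.span_zero)
  ultimately show ?thesis
    unfolding marked_basis_def direct_sum_UNIV_def marked_ideal_def using marked by blast
qed

end

section \<open>The criterion\<close>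

theorem proposition9p5:
  fixes J :: "'x::finite rstruct"
    and prec :: "'x pterm \<Rightarrow> 'x pterm \<Rightarrow> bool"
    and f :: "'x pterm \<Rightarrow> ('x, 'a::field) mpoly"
    and \<alpha> \<alpha>' \<alpha>'' :: "'x pterm"
  assumes "reduction_structure J"
    and "noetherian_rs TYPE('a) J"
    and "disjoint_cones J"
    and "ordered_by J prec"
    and "\<And>\<delta> \<delta>' \<epsilon>. prec \<delta>' \<delta> \<Longrightarrow>
           prec (\<delta>' + \<epsilon>) (\<delta> + \<epsilon>) \<and> (prec \<epsilon> (\<delta>' + \<epsilon>) \<or> \<epsilon> = \<delta>' + \<epsilon>)"
    and "marked_set J f"
    and "\<alpha> \<in> rs_M J" "\<alpha>' \<in> rs_M J" "\<alpha>'' \<in> rs_M J"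
    and "term_dvd \<alpha> (term_lcm \<alpha>' \<alpha>'')"
  shows "marked_basis J f \<longleftrightarrow>
    reduces_final J f (spoly f \<alpha>' \<alpha>) 0 \<and>
    reduces_final J f (spoly f \<alpha>'' \<alpha>) 0 \<and>
    (\<forall>\<beta>\<in>rs_M J. \<forall>\<beta>'\<in>rs_M J.
       term_lcm \<beta> \<beta>' \<in> cone J \<beta>' \<longrightarrow> {\<beta>, \<beta>'} \<noteq> {\<alpha>', \<alpha>''} \<longrightarrow>
       reduces_final J f (spoly f \<beta>' \<beta>) 0)"
proof -
  interpret invariant_marked_rs J f prec
    using assms(1,4,5,6) by unfold_locales auto
  have dvd_lcm: "term_dvd \<beta> (term_lcm \<beta> \<beta>')" "term_dvd \<beta>' (term_lcm \<beta> \<beta>')" for \<beta> \<beta>' :: "'x pterm"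
    unfolding term_dvd_def using term_lcm_minus_plus[of \<beta> \<beta>'] by (metis add.commute)+
  show ?thesis (is "_ \<longleftrightarrow> ?checks")
  proof
    assume basis: "marked_basis J f"
    have "reduces_final J f (spoly f \<beta>' \<beta>) 0" if "\<beta> \<in> rs_M J" "\<beta>' \<in> rs_M J" for \<beta> \<beta>'
    proof (rule marked_basis_reduces_to_0[OF assms(2) basis])
      show "spoly f \<beta>' \<beta> \<in> marked_ideal"
        using multiple_in_ideal[OF that(1)] multiple_in_ideal[OF that(2)]
        unfolding spoly_def marked_ideal_def poly_ideal_def by (intro ideal.span_diff)
    qed
    with assms(7-9) show ?checks by blast
  next
    assume checks: ?checks
    let ?t = "term_lcm \<alpha>' \<alpha>''"
    have "syzygy \<alpha> \<alpha>' ?t \<in> below ?t" "syzygy \<alpha> \<alpha>'' ?t \<in> below ?t"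
      using checks assms(7-10) dvd_lcm by (blast intro: spoly_syzygy)+
    then have skipped: "syzygy \<alpha>' \<alpha>'' ?t \<in> below ?t"
      by (meson syzygy_below_sym syzygy_below_trans)
    have "syzygy \<beta> \<beta>' (term_lcm \<beta> \<beta>') \<in> below (term_lcm \<beta> \<beta>')"
      if M: "\<beta> \<in> rs_M J" "\<beta>' \<in> rs_M J" and cone: "term_lcm \<beta> \<beta>' \<in> cone J \<beta>'" for \<beta> \<beta>'
    proof (cases "{\<beta>, \<beta>'} = {\<alpha>', \<alpha>''}")
      case True
      then consider "\<beta> = \<alpha>'" "\<beta>' = \<alpha>''" | "\<beta> = \<alpha>''" "\<beta>' = \<alpha>'"
        by (auto simp: doubleton_eq_iff)
      then show ?thesis
        using skipped syzygy_below_sym[OF skipped]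
        by cases (simp_all add: term_lcm_commute[of \<alpha>'' \<alpha>'])
    next
      case False
      with checks M cone have "reduces_final J f (spoly f \<beta>' \<beta>) 0" by blast
      with M dvd_lcm show ?thesis by (blast intro: spoly_syzygy)
    qed
    then have "marked_ideal \<subseteq> cone_span UNIV"
      by (rule ideal_subset_cone_span)
    then show "marked_basis J f"
      by (rule marked_basisI[OF assms(2,3)])
  qed
qed

end
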